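(* Let $m$ and $n$ be positive integers. Then (i) $\mathcal{R}(K_{1,n})\cong K_2$; and (ii) if $m,n\geq 2$, then $\mathcal{R}(K_{m,n})\cong K_{2,mn}$.
   Context: All graphs are finite, simple and undirected; $N(v)$ denotes the open neighbourhood of $v$. A set $S\subseteq V(G)$ is a dominating set if every vertex of $G$ is in $S$ or adjacent to a vertex of $S$; it is a minimal dominating set if no proper subset of $S$ is a dominating set. The reconfiguration graph $\mathcal{R}(G)$ has as vertex set the collection of all minimal dominating sets of $G$, and two minimal dominating sets $M_1,M_2$ are adjacent iff there is a vertex $v$ with either ($M_2\setminus M_1=\{v\}$ and $M_1\setminus M_2\subseteq N(v)$) or ($M_1\setminus M_2=\{v\}$ and $M_2\setminus M_1\subseteq N(v)$). *)

theory Defs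
  imports "Graph_Theory.Graph_Theory"
begin

text \<open>
  Finite simple undirected graphs are the symmetric digraphs of the locale \<open>graph\<close>, each edge
  being a pair of opposite arcs. \<open>K\<^bsub>n\<^esub>\<close> and \<open>K\<^bsub>m,n\<^esub>\<close> are the predicates \<open>complete_digraph n\<close> and
  \<open>complete_bipartite_digraph m n\<close>; they are closed under isomorphism.
\<close>

definition open_nbhd :: "('a, 'b) pre_digraph \<Rightarrow> 'a \<Rightarrow> 'a set" where
  "open_nbhd G v = {u \<in> verts G. v \<rightarrow>\<^bsub>G\<^esub> u}"

definition dominating_set :: "('a, 'b) pre_digraph \<Rightarrow> 'a set \<Rightarrow> bool" where
  "dominating_set G S \<longleftrightarrow>
     S \<subseteq> verts G \<and> (\<forall>v \<in> verts G. v \<in> S \<or> (\<exists>u \<in> S. v \<rightarrow>\<^bsub>G\<^esub> u))"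

definition minimal_dominating_set :: "('a, 'b) pre_digraph \<Rightarrow> 'a set \<Rightarrow> bool" where
  "minimal_dominating_set G S \<longleftrightarrow>
     dominating_set G S \<and> (\<forall>T. T \<subset> S \<longrightarrow> \<not> dominating_set G T)"

definition reconf_adj :: "('a, 'b) pre_digraph \<Rightarrow> 'a set \<Rightarrow> 'a set \<Rightarrow> bool" where
  "reconf_adj G M\<^sub>1 M\<^sub>2 \<longleftrightarrow>
     (\<exists>v \<in> verts G. (M\<^sub>2 - M\<^sub>1 = {v} \<and> M\<^sub>1 - M\<^sub>2 \<subseteq> open_nbhd G v) \<or>
                     (M\<^sub>1 - M\<^sub>2 = {v} \<and> M\<^sub>2 - M\<^sub>1 \<subseteq> open_nbhd G v))"

definition reconf_graph :: "('a, 'b) pre_digraph \<Rightarrow> ('a set, 'a set \<times> 'a set) pre_digraph" where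
  "reconf_graph G = with_proj
     \<lparr> pverts = {M. minimal_dominating_set G M},
       parcs = {(M\<^sub>1, M\<^sub>2). minimal_dominating_set G M\<^sub>1 \<and> minimal_dominating_set G M\<^sub>2 \<and>
                           reconf_adj G M\<^sub>1 M\<^sub>2} \<rparr>"

lemma graph_reconf_graph:
  assumes "graph G"
  shows "graph (reconf_graph G)"
proof -
  interpret graph G by fact
  let ?V = "{M. minimal_dominating_set G M}"
  let ?E = "{(M\<^sub>1, M\<^sub>2). minimal_dominating_set G M\<^sub>1 \<and> minimal_dominating_set G M\<^sub>2 \<and>
                           reconf_adj G M\<^sub>1 M\<^sub>2}"
  have "?V \<subseteq> Pow (verts G)"
    by (auto simp: minimal_dominating_set_def dominating_set_def)
  then have fin: "finite ?V"
    by (rule finite_subset) simp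
  have "finite ?E"
    by (rule finite_subset[of _ "?V \<times> ?V"]) (use fin in auto)
  moreover have "sym ?E"
    by (auto simp: sym_def reconf_adj_def)
  moreover have "\<not> reconf_adj G M M" for M
    by (auto simp: reconf_adj_def)
  ultimately show ?thesis
    using fin unfolding reconf_graph_def
    by unfold_locales (auto simp: arc_to_ends_def symmetric_def)
qed

lemma ex_complete_digraph: "\<exists>H :: (nat, nat \<times> nat) pre_digraph. K\<^bsub>n\<^esub> H"
proof
  show "K\<^bsub>n\<^esub> (with_proj \<lparr> pverts = {..<n},
      parcs = {(u, v). (u, v) \<in> {..<n} \<times> {..<n} \<and> u \<noteq> v} \<rparr>)"
    by (simp add: complete_digraph_pair_def)
qed

lemma ex_complete_bipartite_digraph:
  "\<exists>H :: (nat, nat \<times> nat) pre_digraph. K\<^bsub>m,n\<^esub> H"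
proof
  let ?U = "{..<m}" and ?V = "{m..<m + n}"
  have "finite (?U \<union> ?V) \<and> (\<exists>U V. ?U \<union> ?V = U \<union> V \<and> U \<inter> V = {} \<and> card U = m \<and> card V = n \<and>
      ?U \<times> ?V \<union> ?V \<times> ?U = U \<times> V \<union> V \<times> U)"
    by (intro conjI exI[of _ ?U] exI[of _ ?V]) auto
  then show "K\<^bsub>m,n\<^esub> (with_proj \<lparr> pverts = ?U \<union> ?V, parcs = ?U \<times> ?V \<union> ?V \<times> ?U \<rparr>)"
    by (simp add: complete_bipartite_digraph_pair_def)
qed

end

theory Submission
  imports Defs
begin

text \<open>
  In a complete bipartite graph with nonempty parts \<open>U\<close> and \<open>V\<close>, a set of vertices dominates
  iff it contains \<open>U\<close>, or \<open>V\<close>, or some pair \<open>{u, v}\<close> with \<open>u \<in> U\<close>, \<open>v \<in> V\<close>. If both parts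
  have at least two elements, these sets form an antichain, so they are the minimal dominating
  sets; the two parts are then adjacent to exactly the \<open>m * n\<close> pairs. If one part is a
  singleton, the pairs are redundant and only the two parts remain.
\<close>

section \<open>Isomorphisms obtained from vertex bijections\<close>

text \<open>Without parallel arcs an arc is determined by its ends, so the arc map that
  \<open>digraph_iso\<close> also asks for is forced by the vertex map.\<close>

lemma digraph_iso_if_bij_betw:
  assumes "nomulti_digraph G" "nomulti_digraph H"
    and bij: "bij_betw f (verts G) (verts H)"
    and ends: "\<And>u v. u \<in> verts G \<Longrightarrow> v \<in> verts G \<Longrightarrow> u \<rightarrow>\<^bsub>G\<^esub> v \<longleftrightarrow> f u \<rightarrow>\<^bsub>H\<^esub> f v"
  shows "digraph_iso G H"
proof -
  interpret G: nomulti_digraph G by fact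
  interpret H: nomulti_digraph H by fact
  \<comment> \<open>For \<open>e\<close> in \<open>arcs G\<close> this is the unique arc of
    \<open>H\<close> whose ends are the images of the ends of \<open>e\<close>.\<close>
  define g where "g e = the_inv_into (arcs H) (arc_to_ends H) (map_prod f f (arc_to_ends G e))"
    for e
  have inj_f: "inj_on f (verts G)" and img_f: "f ` verts G = verts H"
    using bij by (auto simp: bij_betw_def)
  have g: "g e \<in> arcs H \<and> arc_to_ends H (g e) = map_prod f f (arc_to_ends G e)"
    if "e \<in> arcs G" for e
  proof -
    have "tail G e \<rightarrow>\<^bsub>G\<^esub> head G e"
      using that by (auto simp: arcs_ends_conv)
    then have "map_prod f f (arc_to_ends G e) \<in> arc_to_ends H ` arcs H"
      using that ends by (simp add: arc_to_ends_def[of G] arcs_ends_def[of H, symmetric])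
    then show ?thesis
      unfolding g_def using H.inj_on_arc_to_ends
      by (auto simp: the_inv_into_f_f)
  qed
  have inj_g: "inj_on g (arcs G)"
  proof (rule inj_onI)
    fix e e' assume e: "e \<in> arcs G" "e' \<in> arcs G" "g e = g e'"
    then have "map_prod f f (arc_to_ends G e) = map_prod f f (arc_to_ends G e')"
      using g by metis
    then have "arc_to_ends G e = arc_to_ends G e'"
      using e inj_f by (auto simp: arc_to_ends_def dest: inj_onD)
    with e show "e = e'" by (blast intro: G.no_multi_arcs)
  qed
  have img_g: "g ` arcs G = arcs H"
  proof
    show "g ` arcs G \<subseteq> arcs H" using g by blast
    show "arcs H \<subseteq> g ` arcs G"
    proof
      fix a assume a: "a \<in> arcs H"
      then obtain u v where uv: "u \<in> verts G" "v \<in> verts G" "f u = tail H a" "f v = head H a"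
        using img_f H.wellformed by (metis imageE)
      then have "f u \<rightarrow>\<^bsub>H\<^esub> f v" using a by (auto simp: arcs_ends_conv)
      then have "u \<rightarrow>\<^bsub>G\<^esub> v" using uv ends by blast
      then obtain e where e: "e \<in> arcs G" "arc_to_ends G e = (u, v)"
        by (auto simp: arcs_ends_def)
      then have "arc_to_ends H (g e) = arc_to_ends H a"
        using g uv by (simp add: arc_to_ends_def[of H])
      then have "g e = a" using g e(1) a by (blast intro: H.no_multi_arcs)
      with e(1) show "a \<in> g ` arcs G" by blast
    qed
  qed
  \<comment> \<open>\<open>head H\<close> and \<open>tail H\<close> are taken whole, so that
    \<open>app_iso ?h G\<close> equals \<open>H\<close> as a record and not merely on its
    arcs.\<close>
  let ?h = "\<lparr> iso_verts = f, iso_arcs = g, iso_head = head H, iso_tail = tail H \<rparr>"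
  have "G.digraph_isomorphism ?h"
    unfolding G.digraph_isomorphism_def
    using inj_f inj_g g G.wf_digraph by (auto simp: arc_to_ends_def)
  moreover have "H = app_iso ?h G"
    using img_f img_g by (simp add: app_iso_def)
  ultimately show ?thesis unfolding digraph_iso_def by blast
qed

text \<open>Adjacency in a complete graph is inequality of vertices, which injective maps preserve
  and reflect; any vertex bijection will do.\<close>

lemma complete_digraph_iso:
  assumes "K\<^bsub>n\<^esub> G" "K\<^bsub>n\<^esub> H"
  shows "digraph_iso G H"
proof -
  interpret G: graph G using assms(1) by (simp add: complete_digraph_def)
  interpret H: graph H using assms(2) by (simp add: complete_digraph_def)
  obtain f where f: "bij_betw f (verts G) (verts H)"
    using assms by (metis complete_digraph_def finite_same_card_bij G.finite_verts H.finite_verts)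
  show ?thesis
  proof (rule digraph_iso_if_bij_betw[OF _ _ f])
    show "u \<rightarrow>\<^bsub>G\<^esub> v \<longleftrightarrow> f u \<rightarrow>\<^bsub>H\<^esub> f v" if "u \<in> verts G" "v \<in> verts G" for u v
      using that assms f by (auto simp: complete_digraph_def bij_betw_def dest: inj_onD)
  qed unfold_locales
qed

lemma complete_bipartite_digraph_iso:
  assumes "K\<^bsub>m,n\<^esub> G" "K\<^bsub>m,n\<^esub> H"
  shows "digraph_iso G H"
proof -
  obtain U V where G: "verts G = U \<union> V" "U \<inter> V = {}" "card U = m" "card V = n"
    "arcs_ends G = U \<times> V \<union> V \<times> U" "graph G"
    using assms(1) unfolding complete_bipartite_digraph_def by blast
  obtain U' V' where H: "verts H = U' \<union> V'" "U' \<inter> V' = {}" "card U' = m" "card V' = n"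
    "arcs_ends H = U' \<times> V' \<union> V' \<times> U'" "graph H"
    using assms(2) unfolding complete_bipartite_digraph_def by blast
  interpret G: graph G by fact
  interpret H: graph H by fact
  have "finite U" "finite V" "finite U'" "finite V'"
    using G(1) H(1) G.finite_verts H.finite_verts by auto
  then obtain f g where f: "bij_betw f U U'" and g: "bij_betw g V V'"
    using G(3,4) H(3,4) by (metis finite_same_card_bij)
  define h where "h x = (if x \<in> U then f x else g x)" for x
  have hU: "bij_betw h U U'"
    using f by (simp add: h_def cong: bij_betw_cong)
  have hV: "bij_betw h V V'"
    using g G(2) by (subst bij_betw_cong[of V h g]) (auto simp: h_def)
  have h: "bij_betw h (verts G) (verts H)"
    unfolding G(1) H(1) using hU hV H(2) by (rule bij_betw_combine)
  have img: "h ` U = U'" "h ` V = V'"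
    using hU hV by (auto simp: bij_betw_def)
  show ?thesis
  proof (rule digraph_iso_if_bij_betw[OF _ _ h])
    show "u \<rightarrow>\<^bsub>G\<^esub> v \<longleftrightarrow> h u \<rightarrow>\<^bsub>H\<^esub> h v" if "u \<in> verts G" "v \<in> verts G" for u v
      using that G(1,2,5) H(2,5) img by auto
  qed unfold_locales
qed

section \<open>Minimal dominating sets\<close>

text \<open>A vertex of one part missing from a dominating \<open>S\<close> forces \<open>S\<close>
  to meet the other part, so an \<open>S\<close> containing neither part meets both. Conversely, a
  single vertex dominates the whole opposite part.\<close>

lemma dominating_set_complete_bipartite:
  assumes "verts G = U \<union> V" "arcs_ends G = U \<times> V \<union> V \<times> U" "U \<inter> V = {}" "U \<noteq> {}" "V \<noteq> {}"
  shows "dominating_set G S \<longleftrightarrow>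
    S \<subseteq> verts G \<and> (U \<subseteq> S \<or> V \<subseteq> S \<or> (\<exists>u\<in>U. \<exists>v\<in>V. {u, v} \<subseteq> S))"
  using assms unfolding dominating_set_def by auto

text \<open>A minimal dominating set must equal the member of \<open>F\<close> that it contains. A
  dominating proper subset of a member would contain another member, against the antichain
  property.\<close>

lemma minimal_dominating_sets_eq_antichain:
  assumes dom: "\<And>S. dominating_set G S \<longleftrightarrow> S \<subseteq> verts G \<and> (\<exists>T\<in>F. T \<subseteq> S)"
    and antichain: "\<And>S T. S \<in> F \<Longrightarrow> T \<in> F \<Longrightarrow> T \<subseteq> S \<Longrightarrow> T = S"
    and verts: "\<And>S. S \<in> F \<Longrightarrow> S \<subseteq> verts G"
  shows "{M. minimal_dominating_set G M} = F"
proof (intro set_eqI iffI)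
  fix M assume "M \<in> {M. minimal_dominating_set G M}"
  then obtain T where T: "T \<in> F" "T \<subseteq> M" and min: "\<And>T. T \<subset> M \<Longrightarrow> \<not> dominating_set G T"
    using dom by (auto simp: minimal_dominating_set_def)
  have "dominating_set G T" using T dom verts by blast
  with T min show "M \<in> F" by blast
next
  fix M assume M: "M \<in> F"
  then have "dominating_set G M" using dom verts by blast
  moreover have "\<not> dominating_set G S" if "S \<subset> M" for S
  proof
    assume "dominating_set G S"
    then obtain T where "T \<in> F" "T \<subseteq> S" using dom by blast
    with antichain[OF M, of T] that show False by blast
  qed
  ultimately show "M \<in> {M. minimal_dominating_set G M}"
    by (simp add: minimal_dominating_set_def)
qed

section \<open>Reconfiguration graphs in general and of stars\<close>

lemma verts_reconf_graph: "verts (reconf_graph G) = {M. minimal_dominating_set G M}"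
  by (simp add: reconf_graph_def)

text \<open>Phrased through \<open>verts\<close>, so that the minimal dominating sets, once
  computed, can be substituted and only \<open>reconf_adj\<close> remains to be decided.\<close>

lemma arcs_ends_reconf_graph:
  "arcs_ends (reconf_graph G) =
    {(M, N). M \<in> verts (reconf_graph G) \<and> N \<in> verts (reconf_graph G) \<and> reconf_adj G M N}"
  by (auto simp: reconf_graph_def)

lemma reconf_adj_commute: "reconf_adj G M N \<longleftrightarrow> reconf_adj G N M"
  by (auto simp: reconf_adj_def)

lemma not_reconf_adj_refl: "\<not> reconf_adj G M M"
  by (simp add: reconf_adj_def)

lemma reconf_graph_star:
  assumes "K\<^bsub>1,n\<^esub> G" "n \<ge> 1"
  shows "K\<^bsub>2\<^esub> (reconf_graph G)"
proof -
  obtain U V where G: "verts G = U \<union> V" "U \<inter> V = {}" "card U = 1" "card V = n"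
    "arcs_ends G = U \<times> V \<union> V \<times> U" "graph G"
    using assms(1) unfolding complete_bipartite_digraph_def by blast
  obtain c where U: "U = {c}" using G(3) by (auto simp: card_1_singleton_iff)
  have V: "V \<noteq> {}" using G(4) assms(2) by auto
  \<comment> \<open>Every cross pair contains the singleton \<open>U\<close>, so dominating means
    containing \<open>U\<close> or \<open>V\<close>. These two are incomparable, being disjoint and
    nonempty.\<close>
  have verts: "verts (reconf_graph G) = {U, V}"
    unfolding verts_reconf_graph
    by (rule minimal_dominating_sets_eq_antichain)
      (use U V G(1,2) dominating_set_complete_bipartite[OF G(1,5,2)] in auto)
  have neq: "U \<noteq> V" using G(2) V by blast
  \<comment> \<open>The witness is the centre \<open>c\<close>: \<open>U - V\<close> is
    \<open>{c}\<close>, and all of \<open>V\<close> is adjacent to \<open>c\<close>.\<close>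
  have "reconf_adj G U V"
    using G(1,2,5) U by (auto simp: reconf_adj_def open_nbhd_def)
  then have "arcs_ends (reconf_graph G) =
      {(M, N). (M, N) \<in> verts (reconf_graph G) \<times> verts (reconf_graph G) \<and> M \<noteq> N}"
    unfolding arcs_ends_reconf_graph verts
    using not_reconf_adj_refl by (auto simp: reconf_adj_commute[of G V U])
  then show ?thesis
    unfolding complete_digraph_def using graph_reconf_graph[OF G(6)] neq by (simp add: verts)
qed

section \<open>Reconfiguration graphs when both parts have at least two vertices\<close>

text \<open>Disjointness lets an unordered pair remember which element comes from \<open>U\<close>,
  so ordered pairs can be counted instead.\<close>

lemma card_cross_pairs:
  assumes "U \<inter> V = {}"
  shows "card {{u, v} | u v. u \<in> U \<and> v \<in> V} = card U * card V"
proof -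
  have "inj_on (\<lambda>(u, v). {u, v}) (U \<times> V)"
    using assms by (auto simp: inj_on_def doubleton_eq_iff)
  moreover have "{{u, v} | u v. u \<in> U \<and> v \<in> V} = (\<lambda>(u, v). {u, v}) ` (U \<times> V)"
    by auto
  ultimately show ?thesis by (simp add: card_image card_cartesian_product)
qed

lemma not_subset_singleton_if_card_ge_2:
  assumes "card A \<ge> 2"
  shows "\<not> A \<subseteq> {x}"
  using assms card_mono[of "{x}" A] by auto

text \<open>The vertex \<open>v\<close> enters, and everything that leaves lies in \<open>U\<close>,
  hence in its neighbourhood.\<close>

lemma reconf_adj_part_pair:
  assumes "verts G = U \<union> V" "U \<inter> V = {}" "arcs_ends G = U \<times> V \<union> V \<times> U" "u \<in> U" "v \<in> V"
  shows "reconf_adj G U {u, v}"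
proof -
  have "{u, v} - U = {v}" "U - {u, v} \<subseteq> open_nbhd G v" "v \<in> verts G"
    using assms by (auto simp: open_nbhd_def)
  then show ?thesis unfolding reconf_adj_def by blast
qed

text \<open>Both set differences are entire parts, and neither is a singleton.\<close>

lemma not_reconf_adj_parts:
  assumes "U \<inter> V = {}" "card U \<ge> 2" "card V \<ge> 2"
  shows "\<not> reconf_adj G U V"
proof -
  have "U - V = U" "V - U = V" using assms(1) by auto
  then show ?thesis
    using not_subset_singleton_if_card_ge_2[OF assms(2)]
      not_subset_singleton_if_card_ge_2[OF assms(3)]
    by (auto simp: reconf_adj_def)
qed

text \<open>Pairs sharing one vertex differ by exchanging two vertices of the same part, which are
  not adjacent. For disjoint pairs neither difference is a singleton.\<close>

lemma not_reconf_adj_pairs: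
  assumes "U \<inter> V = {}" "arcs_ends G = U \<times> V \<union> V \<times> U"
    and "u \<in> U" "v \<in> V" "u' \<in> U" "v' \<in> V"
  shows "\<not> reconf_adj G {u, v} {u', v'}"
proof -
  have neq: "u \<noteq> v" "u \<noteq> v'" "u' \<noteq> v" "u' \<noteq> v'" using assms by auto
  show ?thesis
  proof (cases "u = u'"; cases "v = v'")
    assume "u = u'" "v = v'"
    then show ?thesis by (simp add: not_reconf_adj_refl)
  next
    assume "u = u'" "v \<noteq> v'"
    then have "{u, v} - {u', v'} = {v}" "{u', v'} - {u, v} = {v'}" using neq by auto
    then show ?thesis using assms by (auto simp: reconf_adj_def open_nbhd_def)
  next
    assume "u \<noteq> u'" "v = v'"
    then have "{u, v} - {u', v'} = {u}" "{u', v'} - {u, v} = {u'}" using neq by auto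
    then show ?thesis using assms by (auto simp: reconf_adj_def open_nbhd_def)
  next
    assume "u \<noteq> u'" "v \<noteq> v'"
    then have "{u, v} - {u', v'} = {u, v}" "{u', v'} - {u, v} = {u', v'}" using neq by auto
    then show ?thesis using neq by (auto simp: reconf_adj_def)
  qed
qed

lemma reconf_graph_complete_bipartite:
  assumes "K\<^bsub>m,n\<^esub> G" "m \<ge> 2" "n \<ge> 2"
  shows "K\<^bsub>2,m * n\<^esub> (reconf_graph G)"
proof -
  obtain U V where G: "verts G = U \<union> V" "U \<inter> V = {}" "card U = m" "card V = n"
    "arcs_ends G = U \<times> V \<union> V \<times> U" "graph G"
    using assms(1) unfolding complete_bipartite_digraph_def by blast
  define P where "P = {{u, v} | u v. u \<in> U \<and> v \<in> V}"
  have big: "\<not> U \<subseteq> {x}" "\<not> V \<subseteq> {x}" for x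
    using not_subset_singleton_if_card_ge_2[of U] not_subset_singleton_if_card_ge_2[of V]
      G(3,4) assms(2,3) by simp_all
  then have ne: "U \<noteq> {}" "V \<noteq> {}" by blast+
  have UV: "\<not> U \<subseteq> V" "\<not> V \<subseteq> U" using G(2) ne by blast+
  \<comment> \<open>A cross pair has exactly one vertex in each part: too few to contain a part, and
    not all in one part.\<close>
  have U_P: "\<not> U \<subseteq> p" "\<not> p \<subseteq> U" and V_P: "\<not> V \<subseteq> p" "\<not> p \<subseteq> V" if "p \<in> P" for p
  proof -
    obtain u v where p: "p = {u, v}" "u \<in> U" "v \<in> V" using \<open>p \<in> P\<close> by (auto simp: P_def)
    then have "u \<notin> V" "v \<notin> U" using G(2) by auto
    then show "\<not> U \<subseteq> p" "\<not> p \<subseteq> U" "\<not> V \<subseteq> p" "\<not> p \<subseteq> V"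
      using p big(1)[of u] big(2)[of v] by auto
  qed
  have P_P: "p = q" if pq: "p \<in> P" "q \<in> P" "p \<subseteq> q" for p q
  proof -
    obtain u v u' v' where "p = {u, v}" "u \<in> U" "v \<in> V" "q = {u', v'}" "u' \<in> U" "v' \<in> V"
      using pq(1,2) by (auto simp: P_def)
    with pq(3) G(2) show ?thesis by auto
  qed
  have disj: "{U, V} \<inter> P = {}" using U_P V_P by blast
  have verts: "verts (reconf_graph G) = {U, V} \<union> P"
    unfolding verts_reconf_graph
  proof (rule minimal_dominating_sets_eq_antichain)
    show "dominating_set G S \<longleftrightarrow> S \<subseteq> verts G \<and> (\<exists>T\<in>{U, V} \<union> P. T \<subseteq> S)" for S
      unfolding dominating_set_complete_bipartite[OF G(1,5,2) ne] P_def by blast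
    show "T = S" if "S \<in> {U, V} \<union> P" "T \<in> {U, V} \<union> P" "T \<subseteq> S" for S T
      using that UV U_P V_P P_P by blast
    show "S \<subseteq> verts G" if "S \<in> {U, V} \<union> P" for S
      using that G(1) unfolding P_def by blast
  qed
  have adj: "reconf_adj G U p" "reconf_adj G V p" if "p \<in> P" for p
  proof -
    obtain u v where p: "p = {u, v}" "u \<in> U" "v \<in> V" using \<open>p \<in> P\<close> by (auto simp: P_def)
    show "reconf_adj G U p"
      unfolding p(1) using G p by (intro reconf_adj_part_pair[of G U V]) auto
    \<comment> \<open>The same lemma with the two parts exchanged, reading the pair as
      \<open>{v, u}\<close>.\<close>
    show "reconf_adj G V p"
      unfolding p(1) insert_commute[of u] using G p
      by (intro reconf_adj_part_pair[of G V U]) auto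
  qed
  have nadj_parts: "\<not> reconf_adj G M N" if "M \<in> {U, V}" "N \<in> {U, V}" for M N
    using that not_reconf_adj_parts[OF G(2)] G(3,4) assms(2,3)
    by (auto simp: not_reconf_adj_refl reconf_adj_commute[of G V U])
  have nadj_pairs: "\<not> reconf_adj G p q" if "p \<in> P" "q \<in> P" for p q
    using that not_reconf_adj_pairs[OF G(2,5)] unfolding P_def by blast
  have adj': "reconf_adj G p U" "reconf_adj G p V" if "p \<in> P" for p
    using adj[OF that] by (simp_all add: reconf_adj_commute[of G p])
  \<comment> \<open>The bipartition has sides \<open>{U, V}\<close> and \<open>P\<close>; the four
    adjacency facts settle all combinations of sides.\<close>
  have "arcs_ends (reconf_graph G) = {U, V} \<times> P \<union> P \<times> {U, V}"
    unfolding arcs_ends_reconf_graph verts using adj adj' nadj_parts nadj_pairs by auto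
  moreover have "card {U, V} = 2" using UV by (auto simp: card_insert_if)
  moreover have "card P = m * n" unfolding P_def card_cross_pairs[OF G(2)] G(3,4) ..
  ultimately show ?thesis
    unfolding complete_bipartite_digraph_def
    using graph_reconf_graph[OF G(6)] verts disj by blast
qed

theorem theorem5:
  fixes m n :: nat
    and G :: "('a, 'b) pre_digraph"
    and H :: "('c, 'd) pre_digraph"
  assumes "m \<ge> 1" and "n \<ge> 1"
  shows "(K\<^bsub>1,n\<^esub> G \<longrightarrow> K\<^bsub>2\<^esub> H \<longrightarrow> digraph_iso (reconf_graph G) H) \<and>
    (m \<ge> 2 \<longrightarrow> n \<ge> 2 \<longrightarrow> K\<^bsub>m,n\<^esub> G \<longrightarrow> K\<^bsub>2,m * n\<^esub> H \<longrightarrow> digraph_iso (reconf_graph G) H)"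
proof (intro conjI impI)
  \<comment> \<open>\<open>H\<close> is an arbitrary copy of the target, possibly over other types;
    \<open>reconf_graph G\<close> is another copy, and any two copies are isomorphic.\<close>
  assume "K\<^bsub>1,n\<^esub> G" "K\<^bsub>2\<^esub> H"
  then show "digraph_iso (reconf_graph G) H"
    using reconf_graph_star[OF _ assms(2)] complete_digraph_iso by blast
next
  assume "m \<ge> 2" "n \<ge> 2" "K\<^bsub>m,n\<^esub> G" "K\<^bsub>2,m * n\<^esub> H"
  then show "digraph_iso (reconf_graph G) H"
    by (intro complete_bipartite_digraph_iso[OF reconf_graph_complete_bipartite])
qed

end
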